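(* Let $\mathbf{k}$ be a field of characteristic $0$ and $\lambda\in\mathbf{k}$. Let $V$ be a $\mathbf{k}$-vector space and $K_V\in\mathrm{End}_{\mathbf{k}}(V)$. Then $(V,[\cdot,\cdot]_V,K_V)$ with trivial bracket $[\cdot,\cdot]_V=0$ is a modified Rota-Baxter Leibniz algebra (of weight $\lambda$). Let $(\mathfrak{g},[\cdot,\cdot]_{\mathfrak{g}},K)$ be a modified Rota-Baxter Leibniz algebra of weight $\lambda$. Then two isomorphic abelian extensions of $(\mathfrak{g},[\cdot,\cdot]_{\mathfrak{g}},K)$ by $(V,[\cdot,\cdot]_V,K_V)$ give rise to the same cohomology class in $H^2_{\mathrm{MLeib}}(\mathfrak{g},V)$ (where $V$ carries the representation induced by the extensions; it is part of the assertion that the two extensions induce the same representation).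
   Context: A (left) Leibniz algebra is a vector space with a bilinear bracket satisfying $[x,[y,z]]=[[x,y],z]+[y,[x,z]]$. A modified Rota-Baxter Leibniz algebra of weight $\lambda$ is a Leibniz algebra with a linear map $K$ satisfying $[K(x),K(y)]=K([K(x),y]+[x,K(y)])+\lambda[x,y]$. Morphisms are Leibniz algebra homomorphisms commuting with the operators. A representation of a Leibniz algebra $\mathfrak{g}$ is $(V,\rho^L,\rho^R)$ with $\rho^L,\rho^R:\mathfrak{g}\to\mathfrak{gl}(V)$ linear such that $\rho^L([x,y])=\rho^L(x)\rho^L(y)-\rho^L(y)\rho^L(x)$; $\rho^R([x,y])=\rho^L(x)\rho^R(y)-\rho^R(y)\rho^L(x)$; $\rho^R([x,y])=\rho^L(x)\rho^R(y)+\rho^R(y)\rho^R(x)$. A representation over $(\mathfrak{g},[\cdot,\cdot],K)$ of weight $\lambda$ is such a triple with a linear $K_V:V\to V$ such that for $\rho=\rho^L$ and for $\rho=\rho^R$, $\rho(K(x))K_V(v)=K_V(\rho(K(x))v+\rho(x)K_V(v))+\lambda\rho(x)v$. An abelian extension of $(\mathfrak{g},[\cdot,\cdot]_{\mathfrak{g}},K)$ by $(V,[\cdot,\cdot]_V,K_V)$ (zero bracket on $V$) is a short exact sequence $0\to(V,K_V)\xrightarrow{i}(\hat{\mathfrak{g}},\hat K)\xrightarrow{p}(\mathfrak{g},K)\to0$ of morphisms of modified Rota-Baxter Leibniz algebras. Two abelian extensions $(\hat{\mathfrak{g}}_1,\hat K_1,i_1,p_1)$ and $(\hat{\mathfrak{g}}_2,\hat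 K_2,i_2,p_2)$ are isomorphic if there is an isomorphism $\zeta:(\hat{\mathfrak{g}}_1,\hat K_1)\to(\hat{\mathfrak{g}}_2,\hat K_2)$ of modified Rota-Baxter Leibniz algebras with $\zeta\circ i_1=i_2$ and $p_2\circ\zeta=p_1$. Representation and class of an extension: choose a section $s$ (a linear map $s:\mathfrak{g}\to\hat{\mathfrak{g}}$ with $p\circ s=\mathrm{id}_{\mathfrak{g}}$) and, identifying $V$ with $i(V)$, put $\rho^L(x)v=[s(x),i(v)]_{\hat{\mathfrak{g}}}$, $\rho^R(x)v=[i(v),s(x)]_{\hat{\mathfrak{g}}}$, $\psi(x,y)=[s(x),s(y)]_{\hat{\mathfrak{g}}}-s([x,y]_{\mathfrak{g}})$, $\chi(x)=\hat K(s(x))-s(K(x))$. Then $(V,\rho^L,\rho^R,K_V)$ is a representation over $(\mathfrak{g},K)$ independent of $s$, $(\psi,\chi)$ is a 2-cocycle, and its class in $H^2_{\mathrm{MLeib}}(\mathfrak{g},V)$ is independent of $s$; this is the class the extension gives rise to. Cohomology in the degrees needed. Put $[x,y]_K=[K(x),y]+[x,K(y)]$, $\rho^L_K(x)v=\rho^L(K(x))v-K_V(\rho^L(x)v)$, $\rho^R_K(x)v=\rho^R(K(x))v-K_V(\rho^R(x)v)$. - For $f\in\mathrm{Hom}(\mathfrak{g},V)$: $(\delta^1f)(x,y)=\rho^L(x)f(y)+\rho^R(y)f(x)-f([x,y])$ and $\Phi^1(f)=f\circ K-K_V\circ f$. - For $f\in\mathrm{Hom}(\mathfrak{g}^{\otimes2},V)$: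 $(\delta^2f)(x,y,z)=\rho^L(x)f(y,z)-\rho^L(y)f(x,z)-\rho^R(z)f(x,y)-f([x,y],z)-f(y,[x,z])+f(x,[y,z])$ and $\Phi^2(f)(x,y)=f(K(x),K(y))-K_V(f(K(x),y)+f(x,K(y)))-\lambda f(x,y)$. - For $v\in V$: $(\partial^0v)(x)=-\rho^R_K(x)v$. For $g\in\mathrm{Hom}(\mathfrak{g},V)$: $(\partial^1g)(x,y)=\rho^L_K(x)g(y)+\rho^R_K(y)g(x)-g([x,y]_K)$. Set $C^1_{\mathrm{MLeib}}(\mathfrak{g},V)=\mathrm{Hom}(\mathfrak{g},V)\oplus V$, $C^2_{\mathrm{MLeib}}(\mathfrak{g},V)=\mathrm{Hom}(\mathfrak{g}^{\otimes2},V)\oplus\mathrm{Hom}(\mathfrak{g},V)$, $d^1(f,v)=(\delta^1f,-\partial^0v-\Phi^1f)$, $d^2(f,g)=(\delta^2f,-\partial^1g-\Phi^2f)$. 2-cocycles are elements of $\ker d^2$ and $H^2_{\mathrm{MLeib}}(\mathfrak{g},V)=\ker d^2/\mathrm{im}\,d^1$. *)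

theory Defs
  imports Complex_Main "HOL-Library.Function_Algebras" "HOL-Library.Product_Plus"
begin

definition bilinear_map ::
  "('k::field \<Rightarrow> 'a::ab_group_add \<Rightarrow> 'a) \<Rightarrow> ('k \<Rightarrow> 'b::ab_group_add \<Rightarrow> 'b) \<Rightarrow>
   ('k \<Rightarrow> 'c::ab_group_add \<Rightarrow> 'c) \<Rightarrow> ('a \<Rightarrow> 'b \<Rightarrow> 'c) \<Rightarrow> bool" where
  "bilinear_map s1 s2 s3 f \<longleftrightarrow>
     (\<forall>x. Vector_Spaces.linear s2 s3 (f x)) \<and> (\<forall>y. Vector_Spaces.linear s1 s3 (\<lambda>x. f x y))"


text \<open>The underlying vector space is a whole type \<open>'a\<close>, with addition from the class
  \<open>ab_group_add\<close> and scalar multiplication \<open>scl\<close>.\<close>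

record ('k, 'a) leib_op =
  scl :: "'k \<Rightarrow> 'a \<Rightarrow> 'a"
  brk :: "'a \<Rightarrow> 'a \<Rightarrow> 'a"
  opr :: "'a \<Rightarrow> 'a"

definition leibniz_algebra ::
  "('k::field \<Rightarrow> 'a::ab_group_add \<Rightarrow> 'a) \<Rightarrow> ('a \<Rightarrow> 'a \<Rightarrow> 'a) \<Rightarrow> bool" where
  "leibniz_algebra s b \<longleftrightarrow>
     vector_space s \<and> bilinear_map s s s b \<and>
     (\<forall>x y z. b x (b y z) = b (b x y) z + b y (b x z))"

definition mrb_leibniz :: "'k::field \<Rightarrow> ('k, 'a::ab_group_add) leib_op \<Rightarrow> bool" where
  "mrb_leibniz lam A \<longleftrightarrow>
     leibniz_algebra (scl A) (brk A) \<and>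
     Vector_Spaces.linear (scl A) (scl A) (opr A) \<and>
     (\<forall>x y. brk A (opr A x) (opr A y) =
        opr A (brk A (opr A x) y + brk A x (opr A y)) + scl A lam (brk A x y))"

definition mrb_hom ::
  "'k::field \<Rightarrow> ('k, 'a::ab_group_add) leib_op \<Rightarrow> ('k, 'b::ab_group_add) leib_op \<Rightarrow>
   ('a \<Rightarrow> 'b) \<Rightarrow> bool" where
  "mrb_hom lam A B f \<longleftrightarrow>
     mrb_leibniz lam A \<and> mrb_leibniz lam B \<and>
     Vector_Spaces.linear (scl A) (scl B) f \<and>
     (\<forall>x y. f (brk A x y) = brk B (f x) (f y)) \<and>
     (\<forall>x. f (opr A x) = opr B (f x))"

definition mrb_iso ::
  "'k::field \<Rightarrow> ('k, 'a::ab_group_add) leib_op \<Rightarrow> ('k, 'b::ab_group_add) leib_op \<Rightarrow>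
   ('a \<Rightarrow> 'b) \<Rightarrow> bool" where
  "mrb_iso lam A B f \<longleftrightarrow> mrb_hom lam A B f \<and> bij f"

definition trivial_alg ::
  "('k::field \<Rightarrow> 'v::ab_group_add \<Rightarrow> 'v) \<Rightarrow> ('v \<Rightarrow> 'v) \<Rightarrow> ('k, 'v) leib_op" where
  "trivial_alg sV KV = \<lparr>scl = sV, brk = (\<lambda>_ _. 0), opr = KV\<rparr>"


record ('k, 'g, 'v) leib_rep =
  rscl :: "'k \<Rightarrow> 'v \<Rightarrow> 'v"
  rhoL :: "'g \<Rightarrow> 'v \<Rightarrow> 'v"
  rhoR :: "'g \<Rightarrow> 'v \<Rightarrow> 'v"
  ropr :: "'v \<Rightarrow> 'v"

text \<open>Bilinearity of \<open>\<rho>\<close> as a map \<open>'g \<Rightarrow> 'v \<Rightarrow> 'v\<close> says that each \<open>\<rho> x\<close> is an endomorphism of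
  \<open>V\<close> and that \<open>x \<mapsto> \<rho> x\<close> is linear.\<close>

definition mrb_representation ::
  "'k::field \<Rightarrow> ('k, 'g::ab_group_add) leib_op \<Rightarrow> ('k, 'g, 'v::ab_group_add) leib_rep \<Rightarrow> bool" where
  "mrb_representation lam G R \<longleftrightarrow>
     vector_space (rscl R) \<and>
     bilinear_map (scl G) (rscl R) (rscl R) (rhoL R) \<and>
     bilinear_map (scl G) (rscl R) (rscl R) (rhoR R) \<and>
     Vector_Spaces.linear (rscl R) (rscl R) (ropr R) \<and>
     (\<forall>x y v. rhoL R (brk G x y) v = rhoL R x (rhoL R y v) - rhoL R y (rhoL R x v)) \<and>
     (\<forall>x y v. rhoR R (brk G x y) v = rhoL R x (rhoR R y v) - rhoR R y (rhoL R x v)) \<and>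
     (\<forall>x y v. rhoR R (brk G x y) v = rhoL R x (rhoR R y v) + rhoR R y (rhoR R x v)) \<and>
     (\<forall>\<rho>\<in>{rhoL R, rhoR R}. \<forall>x v.
        \<rho> (opr G x) (ropr R v) =
          ropr R (\<rho> (opr G x) v + \<rho> x (ropr R v)) + rscl R lam (\<rho> x v))"


definition brkK :: "('k, 'g::ab_group_add) leib_op \<Rightarrow> 'g \<Rightarrow> 'g \<Rightarrow> 'g" where
  "brkK G x y = brk G (opr G x) y + brk G x (opr G y)"

definition rhoLK ::
  "('k, 'g) leib_op \<Rightarrow> ('k, 'g, 'v::ab_group_add) leib_rep \<Rightarrow> 'g \<Rightarrow> 'v \<Rightarrow> 'v" where
  "rhoLK G R x v = rhoL R (opr G x) v - ropr R (rhoL R x v)"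

definition rhoRK ::
  "('k, 'g) leib_op \<Rightarrow> ('k, 'g, 'v::ab_group_add) leib_rep \<Rightarrow> 'g \<Rightarrow> 'v \<Rightarrow> 'v" where
  "rhoRK G R x v = rhoR R (opr G x) v - ropr R (rhoR R x v)"

definition delta1 ::
  "('k, 'g) leib_op \<Rightarrow> ('k, 'g, 'v::ab_group_add) leib_rep \<Rightarrow> ('g \<Rightarrow> 'v) \<Rightarrow> 'g \<Rightarrow> 'g \<Rightarrow> 'v" where
  "delta1 G R f x y = rhoL R x (f y) + rhoR R y (f x) - f (brk G x y)"

definition Phi1 ::
  "('k, 'g) leib_op \<Rightarrow> ('k, 'g, 'v::ab_group_add) leib_rep \<Rightarrow> ('g \<Rightarrow> 'v) \<Rightarrow> 'g \<Rightarrow> 'v" where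
  "Phi1 G R f x = f (opr G x) - ropr R (f x)"

definition delta2 ::
  "('k, 'g) leib_op \<Rightarrow> ('k, 'g, 'v::ab_group_add) leib_rep \<Rightarrow> ('g \<Rightarrow> 'g \<Rightarrow> 'v) \<Rightarrow>
   'g \<Rightarrow> 'g \<Rightarrow> 'g \<Rightarrow> 'v" where
  "delta2 G R f x y z =
     rhoL R x (f y z) - rhoL R y (f x z) - rhoR R z (f x y)
     - f (brk G x y) z - f y (brk G x z) + f x (brk G y z)"

definition Phi2 ::
  "'k \<Rightarrow> ('k, 'g) leib_op \<Rightarrow> ('k, 'g, 'v::ab_group_add) leib_rep \<Rightarrow> ('g \<Rightarrow> 'g \<Rightarrow> 'v) \<Rightarrow>
   'g \<Rightarrow> 'g \<Rightarrow> 'v" where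
  "Phi2 lam G R f x y =
     f (opr G x) (opr G y) - ropr R (f (opr G x) y + f x (opr G y)) - rscl R lam (f x y)"

definition partial0 ::
  "('k, 'g) leib_op \<Rightarrow> ('k, 'g, 'v::ab_group_add) leib_rep \<Rightarrow> 'v \<Rightarrow> 'g \<Rightarrow> 'v" where
  "partial0 G R v x = - rhoRK G R x v"

definition partial1 ::
  "('k, 'g::ab_group_add) leib_op \<Rightarrow> ('k, 'g, 'v::ab_group_add) leib_rep \<Rightarrow> ('g \<Rightarrow> 'v) \<Rightarrow>
   'g \<Rightarrow> 'g \<Rightarrow> 'v" where
  "partial1 G R g x y = rhoLK G R x (g y) + rhoRK G R y (g x) - g (brkK G x y)"

text \<open>\<open>Hom(G \<otimes> G, V)\<close> is encoded as the set of (curried) bilinear maps. The group structure on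
  cochains is the pointwise and componentwise one of \<open>Function_Algebras\<close> and \<open>Product_Plus\<close>.\<close>

definition C1 ::
  "('k::field, 'g::ab_group_add) leib_op \<Rightarrow> ('k, 'g, 'v::ab_group_add) leib_rep \<Rightarrow>
   (('g \<Rightarrow> 'v) \<times> 'v) set" where
  "C1 G R = {f. Vector_Spaces.linear (scl G) (rscl R) f} \<times> UNIV"

definition C2 ::
  "('k::field, 'g::ab_group_add) leib_op \<Rightarrow> ('k, 'g, 'v::ab_group_add) leib_rep \<Rightarrow>
   (('g \<Rightarrow> 'g \<Rightarrow> 'v) \<times> ('g \<Rightarrow> 'v)) set" where
  "C2 G R = {f. bilinear_map (scl G) (scl G) (rscl R) f} \<times>
            {g. Vector_Spaces.linear (scl G) (rscl R) g}"

fun d1 ::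
  "('k, 'g) leib_op \<Rightarrow> ('k, 'g, 'v::ab_group_add) leib_rep \<Rightarrow> ('g \<Rightarrow> 'v) \<times> 'v \<Rightarrow>
   ('g \<Rightarrow> 'g \<Rightarrow> 'v) \<times> ('g \<Rightarrow> 'v)" where
  "d1 G R (f, v) = (delta1 G R f, - partial0 G R v - Phi1 G R f)"

fun d2 ::
  "'k \<Rightarrow> ('k, 'g::ab_group_add) leib_op \<Rightarrow> ('k, 'g, 'v::ab_group_add) leib_rep \<Rightarrow>
   ('g \<Rightarrow> 'g \<Rightarrow> 'v) \<times> ('g \<Rightarrow> 'v) \<Rightarrow> ('g \<Rightarrow> 'g \<Rightarrow> 'g \<Rightarrow> 'v) \<times> ('g \<Rightarrow> 'g \<Rightarrow> 'v)" where
  "d2 lam G R (f, g) = (delta2 G R f, - partial1 G R g - Phi2 lam G R f)"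

definition Z2 ::
  "'k::field \<Rightarrow> ('k, 'g::ab_group_add) leib_op \<Rightarrow> ('k, 'g, 'v::ab_group_add) leib_rep \<Rightarrow>
   (('g \<Rightarrow> 'g \<Rightarrow> 'v) \<times> ('g \<Rightarrow> 'v)) set" where
  "Z2 lam G R = {c \<in> C2 G R. d2 lam G R c = 0}"

definition B2 ::
  "('k::field, 'g::ab_group_add) leib_op \<Rightarrow> ('k, 'g, 'v::ab_group_add) leib_rep \<Rightarrow>
   (('g \<Rightarrow> 'g \<Rightarrow> 'v) \<times> ('g \<Rightarrow> 'v)) set" where
  "B2 G R = d1 G R ` C1 G R"

definition coh_class ::
  "('k::field, 'g::ab_group_add) leib_op \<Rightarrow> ('k, 'g, 'v::ab_group_add) leib_rep \<Rightarrow>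
   ('g \<Rightarrow> 'g \<Rightarrow> 'v) \<times> ('g \<Rightarrow> 'v) \<Rightarrow> (('g \<Rightarrow> 'g \<Rightarrow> 'v) \<times> ('g \<Rightarrow> 'v)) set" where
  "coh_class G R c = {c + b | b. b \<in> B2 G R}"

definition H2 ::
  "'k::field \<Rightarrow> ('k, 'g::ab_group_add) leib_op \<Rightarrow> ('k, 'g, 'v::ab_group_add) leib_rep \<Rightarrow>
   (('g \<Rightarrow> 'g \<Rightarrow> 'v) \<times> ('g \<Rightarrow> 'v)) set set" where
  "H2 lam G R = coh_class G R ` Z2 lam G R"


definition abelian_extension ::
  "'k::field \<Rightarrow> ('k, 'g::ab_group_add) leib_op \<Rightarrow>
   ('k \<Rightarrow> 'v::ab_group_add \<Rightarrow> 'v) \<Rightarrow> ('v \<Rightarrow> 'v) \<Rightarrow>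
   ('k, 'e::ab_group_add) leib_op \<Rightarrow> ('v \<Rightarrow> 'e) \<Rightarrow> ('e \<Rightarrow> 'g) \<Rightarrow> bool" where
  "abelian_extension lam G sV KV E i p \<longleftrightarrow>
     mrb_hom lam (trivial_alg sV KV) E i \<and> mrb_hom lam E G p \<and>
     inj i \<and> range i = {e. p e = 0} \<and> surj p"

definition isomorphic_extensions ::
  "'k::field \<Rightarrow> ('k, 'e1::ab_group_add) leib_op \<Rightarrow> ('v \<Rightarrow> 'e1) \<Rightarrow> ('e1 \<Rightarrow> 'g) \<Rightarrow>
   ('k, 'e2::ab_group_add) leib_op \<Rightarrow> ('v \<Rightarrow> 'e2) \<Rightarrow> ('e2 \<Rightarrow> 'g) \<Rightarrow> bool" where
  "isomorphic_extensions lam E1 i1 p1 E2 i2 p2 \<longleftrightarrow>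
     (\<exists>\<zeta>. mrb_iso lam E1 E2 \<zeta> \<and> \<zeta> \<circ> i1 = i2 \<and> p2 \<circ> \<zeta> = p1)"

definition is_section ::
  "('k::field, 'g::ab_group_add) leib_op \<Rightarrow> ('k, 'e::ab_group_add) leib_op \<Rightarrow> ('e \<Rightarrow> 'g) \<Rightarrow>
   ('g \<Rightarrow> 'e) \<Rightarrow> bool" where
  "is_section G E p s \<longleftrightarrow> Vector_Spaces.linear (scl G) (scl E) s \<and> p \<circ> s = id"

text \<open>The identification of \<open>V\<close> with \<open>i(V)\<close> is made explicit by \<open>inv i\<close>: for an abelian extension
  every argument of \<open>inv i\<close> below lies in \<open>range i\<close>, the kernel of \<open>p\<close>, and \<open>i\<close> is injective.\<close>

definition induced_rep ::
  "('k \<Rightarrow> 'v \<Rightarrow> 'v) \<Rightarrow> ('v \<Rightarrow> 'v) \<Rightarrow> ('k, 'e) leib_op \<Rightarrow> ('v \<Rightarrow> 'e) \<Rightarrow> ('g \<Rightarrow> 'e) \<Rightarrow>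
   ('k, 'g, 'v) leib_rep" where
  "induced_rep sV KV E i s =
     \<lparr>rscl = sV,
      rhoL = (\<lambda>x v. inv i (brk E (s x) (i v))),
      rhoR = (\<lambda>x v. inv i (brk E (i v) (s x))),
      ropr = KV\<rparr>"

definition induced_cocycle ::
  "('k, 'g) leib_op \<Rightarrow> ('k, 'e::ab_group_add) leib_op \<Rightarrow> ('v \<Rightarrow> 'e) \<Rightarrow> ('g \<Rightarrow> 'e) \<Rightarrow>
   ('g \<Rightarrow> 'g \<Rightarrow> 'v) \<times> ('g \<Rightarrow> 'v)" where
  "induced_cocycle G E i s =
     (\<lambda>x y. inv i (brk E (s x) (s y) - s (brk G x y)),
      \<lambda>x. inv i (opr E (s x) - s (opr G x)))"

text \<open>A section always exists, so quantifying over all sections is never vacuous.\<close>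

lemma ex_section:
  assumes "abelian_extension lam G sV KV E i p"
  shows "\<exists>s. is_section G E p s"
proof -
  have lin: "Vector_Spaces.linear (scl E) (scl G) p" and sur: "surj p"
    using assms by (auto simp: abelian_extension_def mrb_hom_def)
  interpret l: Vector_Spaces.linear "scl E" "scl G" p by (fact lin)
  interpret vp: vector_space_pair "scl E" "scl G" by unfold_locales
  from vp.linear_surjective_right_inverse[OF lin sur] show ?thesis
    by (simp add: is_section_def)
qed

end

theory Submission
  imports Defs
begin

text \<open>An isomorphism of extensions carries a section \<open>s\<close> of the first to the section
  \<open>\<zeta> \<circ> s\<close> of the second, with the same induced actions and the same cocycle on the nose. So
  everything reduces to independence of the section within one extension: two sections differ by
  \<open>i \<circ> f\<close> with \<open>f\<close> linear; as the bracket vanishes on \<open>i(V)\<close> the actions do not change, and the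
  cocycle changes by \<open>d\<^sup>1(f, 0)\<close>.\<close>

section \<open>Linear and bilinear maps as systems of equations; the trivial algebra\<close>

lemma linear_iff_add_scale:
  "Vector_Spaces.linear s1 s2 f \<longleftrightarrow>
     vector_space s1 \<and> vector_space s2 \<and>
     (\<forall>x y. f (x + y) = f x + f y) \<and> (\<forall>c x. f (s1 c x) = s2 c (f x))"
  by (auto simp: Vector_Spaces.linear_def module_hom_def module_hom_axioms_def vector_space_def
      module_def)

lemma linear_add: "Vector_Spaces.linear s1 s2 f \<Longrightarrow> f (x + y) = f x + f y"
  and linear_scale: "Vector_Spaces.linear s1 s2 f \<Longrightarrow> f (s1 c x) = s2 c (f x)"
  by (simp_all add: linear_iff_add_scale)

lemma linear_diff: "Vector_Spaces.linear s1 s2 f \<Longrightarrow> f (x - y) = f x - f y"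
  using linear_add[of s1 s2 f "x - y" y] by simp

lemma linear_zero: "Vector_Spaces.linear s1 s2 f \<Longrightarrow> f 0 = 0"
  using linear_add[of s1 s2 f 0 0] by simp

lemma linear_minus: "Vector_Spaces.linear s1 s2 f \<Longrightarrow> f (- x) = - f x"
  using linear_diff[of s1 s2 f 0 x] linear_zero[of s1 s2 f] by simp

lemma bilinear_map_iff:
  "bilinear_map s1 s2 s3 f \<longleftrightarrow>
     vector_space s1 \<and> vector_space s2 \<and> vector_space s3 \<and>
     (\<forall>x x' y. f (x + x') y = f x y + f x' y) \<and> (\<forall>x y y'. f x (y + y') = f x y + f x y') \<and>
     (\<forall>c x y. f (s1 c x) y = s3 c (f x y)) \<and> (\<forall>c x y. f x (s2 c y) = s3 c (f x y))"
  by (auto simp: bilinear_map_def linear_iff_add_scale)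

lemma bilinear_map_linear:
  assumes "bilinear_map s1 s2 s3 f"
  shows "Vector_Spaces.linear s2 s3 (f x)" "Vector_Spaces.linear s1 s3 (\<lambda>x. f x y)"
  using assms by (auto simp: bilinear_map_def)

text \<open>With zero bracket both identities collapse to statements that \<open>KV\<close> and
  scalar multiplication send 0 to 0.\<close>

lemma mrb_leibniz_trivial_alg:
  assumes "vector_space sV" "Vector_Spaces.linear sV sV KV"
  shows "mrb_leibniz lam (trivial_alg sV KV)"
proof -
  interpret vector_space sV by fact
  show ?thesis
    using assms linear_zero[OF assms(2)]
    by (simp add: mrb_leibniz_def leibniz_algebra_def bilinear_map_iff trivial_alg_def)
qed

lemma mrb_representationD:
  assumes "mrb_representation lam G R"
  shows "bilinear_map (scl G) (rscl R) (rscl R) (rhoL R)"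
    and "bilinear_map (scl G) (rscl R) (rscl R) (rhoR R)"
    and "Vector_Spaces.linear (rscl R) (rscl R) (ropr R)"
  using assms by (auto simp: mrb_representation_def)

section \<open>Coboundaries and cohomology classes\<close>

lemma d1_diff:
  assumes "mrb_representation lam G R"
  shows "d1 G R (a - b) = d1 G R a - d1 G R b"
proof -
  note R = mrb_representationD[OF assms]
  note L = bilinear_map_linear[OF R(1)] bilinear_map_linear[OF R(2)] R(3)
  show ?thesis
    by (cases a; cases b)
      (simp add: fun_eq_iff delta1_def partial0_def Phi1_def rhoRK_def linear_diff[OF L(1)]
        linear_diff[OF L(3)] linear_diff[OF L(5)])
qed

lemma C1_diff:
  assumes "a \<in> C1 G R" "b \<in> C1 G R"
  shows "a - b \<in> C1 G R"
proof -
  obtain f v g w where ab: "a = (f, v)" "b = (g, w)" by (cases a; cases b)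
  with assms have f: "Vector_Spaces.linear (scl G) (rscl R) f"
    and g: "Vector_Spaces.linear (scl G) (rscl R) g"
    by (auto simp: C1_def)
  then interpret vector_space "rscl R" by (simp add: linear_iff_add_scale)
  from f g show ?thesis
    by (simp add: ab C1_def linear_iff_add_scale scale_right_diff_distrib)
qed

text \<open>This holds because \<open>d1\<close> respects differences and \<open>C1\<close> is
  closed under them. Differences alone suffice, as negatives and sums follow from them.\<close>

lemma B2_diff:
  assumes "mrb_representation lam G R" "a \<in> B2 G R" "b \<in> B2 G R"
  shows "a - b \<in> B2 G R"
proof -
  obtain a' b' where ab: "a = d1 G R a'" "b = d1 G R b'" and C1: "a' \<in> C1 G R" "b' \<in> C1 G R"
    using assms(2,3) unfolding B2_def by blast
  have "a - b = d1 G R (a' - b')" by (simp only: ab d1_diff[OF assms(1)])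
  then show ?thesis unfolding B2_def by (rule image_eqI) (rule C1_diff[OF C1])
qed

text \<open>Splits the vanishing of \<open>d2\<close> into pointwise equations in V, which can then
  be checked inside an extension.\<close>

lemma Z2_iff:
  "(f, g) \<in> Z2 lam G R \<longleftrightarrow>
     bilinear_map (scl G) (scl G) (rscl R) f \<and> Vector_Spaces.linear (scl G) (rscl R) g \<and>
     (\<forall>x y z. delta2 G R f x y z = 0) \<and> (\<forall>x y. - partial1 G R g x y - Phi2 lam G R f x y = 0)"
  by (simp only: Z2_def C2_def mem_Collect_eq mem_Times_iff fst_conv snd_conv d2.simps
      zero_prod_def prod.inject fun_eq_iff zero_fun_def minus_apply uminus_apply conj_assoc)

text \<open>Closure under differences makes \<open>B2\<close> a subgroup, and the classes are its
  cosets.\<close>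

lemma coh_class_eqI:
  assumes R: "mrb_representation lam G R" and b: "c' - c \<in> B2 G R"
  shows "coh_class G R c' = coh_class G R c"
proof -
  have neg: "- x \<in> B2 G R" if "x \<in> B2 G R" for x
    using B2_diff[OF R B2_diff[OF R that that] that] by simp
  have add: "x + y \<in> B2 G R" if "x \<in> B2 G R" "y \<in> B2 G R" for x y
    using B2_diff[OF R that(1) neg[OF that(2)]] by simp
  have "\<exists>b'. c' + x = c + b' \<and> b' \<in> B2 G R" if "x \<in> B2 G R" for x
    using add[OF b that] by (intro exI[of _ "c' - c + x"]) simp
  moreover have "\<exists>b'. c + x = c' + b' \<and> b' \<in> B2 G R" if "x \<in> B2 G R" for x
    using B2_diff[OF R that b] by (intro exI[of _ "x - (c' - c)"]) simp
  ultimately show ?thesis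
    unfolding coh_class_def by blast
qed

section \<open>One abelian extension with a chosen section\<close>

locale abelian_extension_section =
  fixes lam :: "'k::field" and G :: "('k, 'g::ab_group_add) leib_op"
    and sV :: "'k \<Rightarrow> 'v::ab_group_add \<Rightarrow> 'v" and KV :: "'v \<Rightarrow> 'v"
    and E :: "('k, 'e::ab_group_add) leib_op" and i :: "'v \<Rightarrow> 'e" and p :: "'e \<Rightarrow> 'g"
    and s :: "'g \<Rightarrow> 'e"
  assumes ext: "abelian_extension lam G sV KV E i p"
    and sec: "is_section G E p s"
begin

abbreviation "R \<equiv> induced_rep sV KV E i s"
abbreviation "\<psi> \<equiv> fst (induced_cocycle G E i s)"
abbreviation "\<chi> \<equiv> snd (induced_cocycle G E i s)"

lemma mrb_trivial: "mrb_leibniz lam (trivial_alg sV KV)"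
  and mrb_E: "mrb_leibniz lam E" and mrb_G: "mrb_leibniz lam G"
  and lin_i: "Vector_Spaces.linear sV (scl E) i"
  and lin_p: "Vector_Spaces.linear (scl E) (scl G) p"
  and i_opr: "i (KV v) = opr E (i v)"
  and p_opr: "p (opr E e) = opr G (p e)"
  and p_brk: "p (brk E e e') = brk G (p e) (p e')"
  and inj_i: "inj i" and range_i: "range i = {e. p e = 0}"
  using ext by (auto simp: abelian_extension_def mrb_hom_def trivial_alg_def)

text \<open>The one place where the zero bracket on V enters: \<open>i\<close> is a morphism, so it
  carries that bracket into E.\<close>

lemma brk_i_i: "brk E (i v) (i w) = 0"
proof -
  have "brk E (i v) (i w) = i 0"
    using ext by (simp add: abelian_extension_def mrb_hom_def trivial_alg_def)
  then show ?thesis by (simp add: linear_zero[OF lin_i])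
qed

lemma lin_s: "Vector_Spaces.linear (scl G) (scl E) s" and p_s: "p (s x) = x"
  using sec by (auto simp: is_section_def fun_eq_iff)

lemma p_i: "p (i v) = 0"
  using range_i by auto

text \<open>Exactness in the middle makes \<open>inv i\<close> a genuine inverse on the kernel of
  \<open>p\<close>.\<close>

lemma i_inv_i: "p e = 0 \<Longrightarrow> i (inv i e) = e"
  using range_i by (auto intro: f_inv_into_f)

text \<open>Used from right to left below: an equation in V is mapped into E by \<open>i\<close>,
  where the induced data become honest brackets and operator values.\<close>

lemma i_eq_iff: "i v = i w \<longleftrightarrow> v = w"
  using inj_i by (auto dest: injD)

lemma bilin_E: "bilinear_map (scl E) (scl E) (scl E) (brk E)"
  and lin_oprE: "Vector_Spaces.linear (scl E) (scl E) (opr E)"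
  and leibniz_E: "brk E x (brk E y z) = brk E (brk E x y) z + brk E y (brk E x z)"
  and mrb_E_eq: "brk E (opr E x) (opr E y) =
     opr E (brk E (opr E x) y + brk E x (opr E y)) + scl E lam (brk E x y)"
  using mrb_E unfolding mrb_leibniz_def leibniz_algebra_def by blast+

lemma bilin_G: "bilinear_map (scl G) (scl G) (scl G) (brk G)"
  and lin_oprG: "Vector_Spaces.linear (scl G) (scl G) (opr G)"
  and mrb_G_eq: "brk G (opr G x) (opr G y) =
     opr G (brk G (opr G x) y + brk G x (opr G y)) + scl G lam (brk G x y)"
  and leibniz_G: "brk G x (brk G y z) = brk G (brk G x y) z + brk G y (brk G x z)"
  using mrb_G unfolding mrb_leibniz_def leibniz_algebra_def by blast+

lemma lin_KV: "Vector_Spaces.linear sV sV KV"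
  using mrb_trivial by (simp add: mrb_leibniz_def trivial_alg_def)

lemma vector_spaces: "vector_space sV" "vector_space (scl E)" "vector_space (scl G)"
  using lin_i lin_p by (auto simp: linear_iff_add_scale)

lemmas i_linear = linear_add[OF lin_i] linear_diff[OF lin_i] linear_scale[OF lin_i]
  linear_minus[OF lin_i] linear_zero[OF lin_i]
lemmas s_linear = linear_add[OF lin_s] linear_diff[OF lin_s] linear_scale[OF lin_s]
  linear_minus[OF lin_s] linear_zero[OF lin_s]
lemmas p_linear = linear_add[OF lin_p] linear_diff[OF lin_p] linear_scale[OF lin_p]
  linear_minus[OF lin_p] linear_zero[OF lin_p]
lemmas oprE_linear = linear_add[OF lin_oprE] linear_diff[OF lin_oprE] linear_scale[OF lin_oprE]
  linear_minus[OF lin_oprE] linear_zero[OF lin_oprE]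
lemmas oprG_linear = linear_add[OF lin_oprG] linear_diff[OF lin_oprG] linear_scale[OF lin_oprG]
lemmas brkE_linear =
  bilinear_map_linear(1)[OF bilin_E, THEN linear_add]
  bilinear_map_linear(2)[OF bilin_E, THEN linear_add]
  bilinear_map_linear(1)[OF bilin_E, THEN linear_diff]
  bilinear_map_linear(2)[OF bilin_E, THEN linear_diff]
  bilinear_map_linear(1)[OF bilin_E, THEN linear_scale]
  bilinear_map_linear(2)[OF bilin_E, THEN linear_scale]
  bilinear_map_linear(1)[OF bilin_E, THEN linear_zero]
  bilinear_map_linear(2)[OF bilin_E, THEN linear_zero]
lemmas brkG_linear =
  bilinear_map_linear(1)[OF bilin_G, THEN linear_add]
  bilinear_map_linear(2)[OF bilin_G, THEN linear_add]
  bilinear_map_linear(1)[OF bilin_G, THEN linear_scale]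
  bilinear_map_linear(2)[OF bilin_G, THEN linear_scale]
  bilinear_map_linear(1)[OF bilin_G, THEN linear_zero]
  bilinear_map_linear(2)[OF bilin_G, THEN linear_zero]

section \<open>The induced representation and cocycle\<close>

lemma rep_simps: "rscl R = sV" "ropr R = KV"
  by (simp_all add: induced_rep_def)

text \<open>Both brackets lie in the kernel of \<open>p\<close>, because \<open>p\<close> kills
  \<open>i v\<close>.\<close>

lemma i_rhoL: "i (rhoL R x v) = brk E (s x) (i v)"
  and i_rhoR: "i (rhoR R x v) = brk E (i v) (s x)"
  by (simp_all add: induced_rep_def i_inv_i p_brk p_i brkG_linear)

text \<open>As \<open>p\<close> is a morphism and inverts \<open>s\<close> from the left, it sends
  the two terms of each difference to the same element.\<close>

lemma i_psi: "i (\<psi> x y) = brk E (s x) (s y) - s (brk G x y)"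
  and i_chi: "i (\<chi> x) = opr E (s x) - s (opr G x)"
  by (simp_all add: induced_cocycle_def i_inv_i p_brk p_opr p_s p_linear)

lemmas i_simps = i_linear i_opr i_rhoL i_rhoR i_psi i_chi

text \<open>The section fails to preserve brackets only by \<open>i (\<psi> x y)\<close>, which
  brackets to zero with \<open>i v\<close>.\<close>

lemma brk_s_brk:
  "brk E (s (brk G x y)) (i v) = brk E (brk E (s x) (s y)) (i v)"
  "brk E (i v) (s (brk G x y)) = brk E (i v) (brk E (s x) (s y))"
  using brk_i_i[of "\<psi> x y" v] brk_i_i[of v "\<psi> x y"] by (simp_all add: i_psi brkE_linear)

text \<open>The same argument for the operators, with the defect
  \<open>i (\<chi> x)\<close>.\<close>

lemma brk_s_opr:
  "brk E (s (opr G x)) (i v) = brk E (opr E (s x)) (i v)"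
  "brk E (i v) (s (opr G x)) = brk E (i v) (opr E (s x))"
  using brk_i_i[of "\<chi> x" v] brk_i_i[of v "\<chi> x"] by (simp_all add: i_chi brkE_linear)

text \<open>The three bracket axioms are the Leibniz identity of E with \<open>i v\<close> in the
  third, second and first place; the operator axioms are the weighted identity of E with one
  argument \<open>i v\<close>.\<close>

lemma representation: "mrb_representation lam G R"
  unfolding mrb_representation_def
proof (intro conjI ballI allI)
  show "vector_space (rscl R)" "Vector_Spaces.linear (rscl R) (rscl R) (ropr R)"
    by (simp_all add: rep_simps vector_spaces lin_KV)
  show "bilinear_map (scl G) (rscl R) (rscl R) (rhoL R)"
    "bilinear_map (scl G) (rscl R) (rscl R) (rhoR R)"
    by (simp_all add: bilinear_map_iff rep_simps vector_spaces i_eq_iff[symmetric] i_simps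
        s_linear brkE_linear)
  fix x y v
  show "rhoL R (brk G x y) v = rhoL R x (rhoL R y v) - rhoL R y (rhoL R x v)"
    using leibniz_E[of "s x" "s y" "i v"]
    by (simp add: i_eq_iff[symmetric] i_simps brk_s_brk)
  show "rhoR R (brk G x y) v = rhoL R x (rhoR R y v) - rhoR R y (rhoL R x v)"
    using leibniz_E[of "s x" "i v" "s y"]
    by (simp add: i_eq_iff[symmetric] i_simps brk_s_brk)
  show "rhoR R (brk G x y) v = rhoL R x (rhoR R y v) + rhoR R y (rhoR R x v)"
    using leibniz_E[of "i v" "s x" "s y"]
    by (simp add: i_eq_iff[symmetric] i_simps brk_s_brk)
next
  fix \<rho> x v
  \<comment> \<open>The identity in E pairs \<open>opr E (s x)\<close> with both \<open>i v\<close>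
    and \<open>i (KV v)\<close>, hence two instances of \<open>brk_s_opr\<close>.\<close>
  have "rhoL R (opr G x) (KV v) = KV (rhoL R (opr G x) v + rhoL R x (KV v)) + sV lam (rhoL R x v)"
    using mrb_E_eq[of "s x" "i v"] brk_s_opr(1)[of x v] brk_s_opr(1)[of x "KV v"]
    by (simp add: i_eq_iff[symmetric] i_simps)
  moreover have
    "rhoR R (opr G x) (KV v) = KV (rhoR R (opr G x) v + rhoR R x (KV v)) + sV lam (rhoR R x v)"
    using mrb_E_eq[of "i v" "s x"] brk_s_opr(2)[of v x] brk_s_opr(2)[of "KV v" x]
    by (simp add: i_eq_iff[symmetric] i_simps add.commute)
  moreover assume "\<rho> \<in> {rhoL R, rhoR R}"
  ultimately show
    "\<rho> (opr G x) (ropr R v) = ropr R (\<rho> (opr G x) v + \<rho> x (ropr R v)) + rscl R lam (\<rho> x v)"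
    unfolding rep_simps by blast
qed

text \<open>\<open>\<psi>\<close> and \<open>\<chi>\<close> measure how far \<open>s\<close> is from
  a morphism. The cocycle equations compare the Leibniz and operator identities of E on the image of
  \<open>s\<close> with those of G.\<close>

lemma cocycle: "induced_cocycle G E i s \<in> Z2 lam G R"
proof -
  interpret vE: vector_space "scl E" by (fact vector_spaces)
  have "bilinear_map (scl G) (scl G) sV \<psi>" "Vector_Spaces.linear (scl G) sV \<chi>"
    by (simp_all add: bilinear_map_iff linear_iff_add_scale vector_spaces i_eq_iff[symmetric]
        i_simps s_linear brkE_linear brkG_linear oprE_linear oprG_linear
        vE.scale_right_diff_distrib algebra_simps)
  moreover have "delta2 G R \<psi> x y z = 0" for x y z
  proof -
    have "i (delta2 G R \<psi> x y z) = i 0"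
      using leibniz_E[of "s x" "s y" "s z"] leibniz_G[of x y z]
      by (simp add: delta2_def i_simps brkE_linear s_linear)
    then show ?thesis by (simp only: i_eq_iff)
  qed
  moreover have "- partial1 G R \<chi> x y - Phi2 lam G R \<psi> x y = 0" for x y
  proof -
    \<comment> \<open>Expanding the vanishing bracket of \<open>i (\<chi> x)\<close> and
      \<open>i (\<chi> y)\<close> rewrites a bracket that occurs in both \<open>partial1\<close> and
      \<open>Phi2\<close>.\<close>
    have chi_chi: "brk E (s (opr G x)) (s (opr G y)) = brk E (s (opr G x)) (opr E (s y))
        + brk E (opr E (s x)) (s (opr G y)) - brk E (opr E (s x)) (opr E (s y))"
      using brk_i_i[of "\<chi> x" "\<chi> y"] by (simp add: i_chi brkE_linear algebra_simps)
    have "i (- partial1 G R \<chi> x y - Phi2 lam G R \<psi> x y) = i 0"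
      using mrb_E_eq[of "s x" "s y"] chi_chi
      by (simp add: partial1_def Phi2_def rhoLK_def rhoRK_def brkK_def rep_simps i_simps
          brkE_linear s_linear oprE_linear oprG_linear vE.scale_right_diff_distrib mrb_G_eq)
    then show ?thesis by (simp only: i_eq_iff)
  qed
  ultimately show ?thesis
    using Z2_iff[of \<psi> \<chi> lam G R] by (simp only: prod.collapse rep_simps simp_thms)
qed

section \<open>Independence of the section\<close>

lemma induced_rep_unique:
  assumes "is_section G E p s'"
  shows "induced_rep sV KV E i s' = R"
proof -
  have "brk E (s' x) (i v) = brk E (s x) (i v)" "brk E (i v) (s' x) = brk E (i v) (s x)" for x v
  proof -
    have "p (s' x - s x) = 0"
      using assms by (simp add: is_section_def fun_eq_iff p_linear p_s)
    then obtain w where "s' x - s x = i w" by (metis i_inv_i)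
    then have "s' x = s x + i w" by (simp add: algebra_simps)
    then show "brk E (s' x) (i v) = brk E (s x) (i v)" "brk E (i v) (s' x) = brk E (i v) (s x)"
      by (simp_all add: brkE_linear brk_i_i)
  qed
  then show ?thesis by (simp add: induced_rep_def)
qed

lemma coh_class_unique:
  assumes s': "is_section G E p s'"
  shows "coh_class G R (induced_cocycle G E i s') = coh_class G R (induced_cocycle G E i s)"
proof (rule coh_class_eqI[OF representation])
  interpret s': abelian_extension_section lam G sV KV E i p s'
    using ext s' by unfold_locales
  interpret vE: vector_space "scl E" by (fact vector_spaces)
  define f where "f x = inv i (s' x - s x)" for x
  have i_f: "i (f x) = s' x - s x" for x
    by (simp add: f_def i_inv_i p_linear p_s s'.p_s)
  have "Vector_Spaces.linear (scl G) sV f"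
    by (simp add: linear_iff_add_scale vector_spaces i_eq_iff[symmetric] i_linear i_f
        s_linear s'.s_linear vE.scale_right_diff_distrib)
  \<comment> \<open>The component in V is 0: a change of section is accounted for by
    \<open>f\<close> alone, and the \<open>partial0\<close> term vanishes.\<close>
  moreover have "induced_cocycle G E i s' - induced_cocycle G E i s = d1 G R (f, 0)"
  proof -
    have "s'.\<psi> x y - \<psi> x y = delta1 G R f x y" for x y
    proof -
      \<comment> \<open>This quadratic term is exactly what separates the change of
        \<open>\<psi>\<close> from \<open>delta1 G R f\<close>.\<close>
      have "brk E (i (f x)) (i (f y)) = 0" by (rule brk_i_i)
      then show ?thesis
        unfolding i_eq_iff[symmetric]
        by (simp add: delta1_def i_simps s'.i_psi i_f brkE_linear algebra_simps)
    qed
    moreover have "s'.\<chi> x - \<chi> x = - partial0 G R 0 x - Phi1 G R f x" for x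
      unfolding i_eq_iff[symmetric]
      by (simp add: partial0_def Phi1_def rhoRK_def i_simps s'.i_chi i_f rep_simps
          brkE_linear oprE_linear)
    ultimately show ?thesis
      by (simp add: prod_eq_iff fun_eq_iff)
  qed
  ultimately show "induced_cocycle G E i s' - induced_cocycle G E i s \<in> B2 G R"
    unfolding B2_def by (auto simp: C1_def rep_simps simp del: d1.simps)
qed

end

text \<open>The induced data are values of \<open>inv i1\<close> on the kernel of \<open>p1\<close>.
  Applying \<open>\<zeta>\<close> to the argument and passing to \<open>inv i2\<close> gives the
  same vector.\<close>

lemma section_transport:
  assumes iso: "mrb_iso lam E1 E2 \<zeta>" and i2: "\<zeta> \<circ> i1 = i2" and p1: "p2 \<circ> \<zeta> = p1"
    and ext1: "abelian_extension lam G sV KV E1 i1 p1"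
    and ext2: "abelian_extension lam G sV KV E2 i2 p2"
    and s: "is_section G E1 p1 s"
  shows "is_section G E2 p2 (\<zeta> \<circ> s)"
    and "induced_rep sV KV E2 i2 (\<zeta> \<circ> s) = induced_rep sV KV E1 i1 s"
    and "induced_cocycle G E2 i2 (\<zeta> \<circ> s) = induced_cocycle G E1 i1 s"
proof -
  have lin: "Vector_Spaces.linear (scl E1) (scl E2) \<zeta>"
    and brk: "\<zeta> (brk E1 x y) = brk E2 (\<zeta> x) (\<zeta> y)"
    and opr: "\<zeta> (opr E1 x) = opr E2 (\<zeta> x)" for x y
    using iso by (auto simp: mrb_iso_def mrb_hom_def)
  show sec: "is_section G E2 p2 (\<zeta> \<circ> s)"
    using s lin p1 by (auto simp: is_section_def linear_iff_add_scale fun_eq_iff)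
  interpret s1: abelian_extension_section lam G sV KV E1 i1 p1 s
    using ext1 s by unfold_locales
  interpret s2: abelian_extension_section lam G sV KV E2 i2 p2 "\<zeta> \<circ> s"
    using ext2 sec by unfold_locales
  have z: "i2 v = \<zeta> (i1 v)" for v using i2 by auto
  \<comment> \<open>Here \<open>e\<close> is \<open>i1 v\<close> for some \<open>v\<close>, so
    \<open>\<zeta> e\<close> is \<open>i2 v\<close>.\<close>
  have inv: "inv i2 (\<zeta> e) = inv i1 e" if "p1 e = 0" for e
    using s1.i_inv_i[OF that] z s2.inj_i by (metis inv_f_f)
  show "induced_rep sV KV E2 i2 (\<zeta> \<circ> s) = induced_rep sV KV E1 i1 s"
    by (simp add: induced_rep_def z brk[symmetric] inv s1.p_brk s1.p_i s1.brkG_linear)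
  show "induced_cocycle G E2 i2 (\<zeta> \<circ> s) = induced_cocycle G E1 i1 s"
    by (simp add: induced_cocycle_def brk[symmetric] opr[symmetric] linear_diff[OF lin, symmetric]
        inv s1.p_brk s1.p_opr s1.p_s s1.p_linear)
qed

text \<open>\<open>R\<close> and \<open>c\<close> are quantified before the sections, so
  independence of the section is asserted together with invariance under isomorphism.\<close>

theorem proposition5p6:
  fixes lam :: "'k::field_char_0"
    and sV :: "'k \<Rightarrow> 'v::ab_group_add \<Rightarrow> 'v" and KV :: "'v \<Rightarrow> 'v"
    and G :: "('k, 'g::ab_group_add) leib_op"
  assumes "vector_space sV"
    and "Vector_Spaces.linear sV sV KV"
    and "mrb_leibniz lam G"
  shows "mrb_leibniz lam (trivial_alg sV KV) \<and>
    (\<forall>(E1 :: ('k, 'e1::ab_group_add) leib_op) i1 p1 (E2 :: ('k, 'e2::ab_group_add) leib_op) i2 p2.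
       abelian_extension lam G sV KV E1 i1 p1 \<longrightarrow>
       abelian_extension lam G sV KV E2 i2 p2 \<longrightarrow>
       isomorphic_extensions lam E1 i1 p1 E2 i2 p2 \<longrightarrow>
       (\<exists>R. mrb_representation lam G R \<and>
          (\<exists>c \<in> H2 lam G R.
             (\<forall>s1. is_section G E1 p1 s1 \<longrightarrow>
                induced_rep sV KV E1 i1 s1 = R \<and>
                coh_class G R (induced_cocycle G E1 i1 s1) = c) \<and>
             (\<forall>s2. is_section G E2 p2 s2 \<longrightarrow>
                induced_rep sV KV E2 i2 s2 = R \<and>
                coh_class G R (induced_cocycle G E2 i2 s2) = c))))"
proof (intro conjI allI impI)
  show "mrb_leibniz lam (trivial_alg sV KV)"
    by (rule mrb_leibniz_trivial_alg) fact+
next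
  fix E1 :: "('k, 'e1) leib_op" and i1 p1 and E2 :: "('k, 'e2) leib_op" and i2 p2
  assume ext1: "abelian_extension lam G sV KV E1 i1 p1"
    and ext2: "abelian_extension lam G sV KV E2 i2 p2"
    and "isomorphic_extensions lam E1 i1 p1 E2 i2 p2"
  then obtain \<zeta> where iso: "mrb_iso lam E1 E2 \<zeta>" "\<zeta> \<circ> i1 = i2" "p2 \<circ> \<zeta> = p1"
    by (auto simp: isomorphic_extensions_def)
  from ex_section[OF ext1] obtain s where s: "is_section G E1 p1 s" ..
  note transport = section_transport[OF iso ext1 ext2 s]
  interpret s1: abelian_extension_section lam G sV KV E1 i1 p1 s
    using ext1 s by unfold_locales
  interpret s2: abelian_extension_section lam G sV KV E2 i2 p2 "\<zeta> \<circ> s"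
    using ext2 transport(1) by unfold_locales
  show "\<exists>R. mrb_representation lam G R \<and>
          (\<exists>c \<in> H2 lam G R.
             (\<forall>s1. is_section G E1 p1 s1 \<longrightarrow>
                induced_rep sV KV E1 i1 s1 = R \<and>
                coh_class G R (induced_cocycle G E1 i1 s1) = c) \<and>
             (\<forall>s2. is_section G E2 p2 s2 \<longrightarrow>
                induced_rep sV KV E2 i2 s2 = R \<and>
                coh_class G R (induced_cocycle G E2 i2 s2) = c))"
  \<comment> \<open>Both witnesses come from the single section \<open>s\<close> of the first
    extension.\<close>
  proof (intro exI conjI bexI)
    show "mrb_representation lam G s1.R" by (rule s1.representation)
    show "coh_class G s1.R (induced_cocycle G E1 i1 s) \<in> H2 lam G s1.R"
      unfolding H2_def by (intro imageI s1.cocycle)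
    show "\<forall>s1. is_section G E1 p1 s1 \<longrightarrow> induced_rep sV KV E1 i1 s1 = s1.R \<and>
        coh_class G s1.R (induced_cocycle G E1 i1 s1) = coh_class G s1.R (induced_cocycle G E1 i1 s)"
      by (intro allI impI conjI s1.induced_rep_unique s1.coh_class_unique)
    show "\<forall>s2. is_section G E2 p2 s2 \<longrightarrow> induced_rep sV KV E2 i2 s2 = s1.R \<and>
        coh_class G s1.R (induced_cocycle G E2 i2 s2) = coh_class G s1.R (induced_cocycle G E1 i1 s)"
      \<comment> \<open>Uniqueness in the second extension refers to
        \<open>\<zeta> \<circ> s\<close>; the transport equations turn its data into those of
        \<open>s\<close>.\<close>
      using s2.induced_rep_unique s2.coh_class_unique unfolding transport(2,3) by (intro allI impI conjI)
  qed
qed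

end
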